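(* Let $n\ge 1$ and $F = (x_1^2-1,\ldots,x_n^2-1)$. The SDP exact region $\mathcal{R}_F$ consists of $2^n$ spectrahedra, which are invertible linear transformations of $$\mathcal{S} = \left\{(C,c) \in \mathrm{Sym}_n(\mathbb{R})\times\mathbb{R}^n : \begin{bmatrix} - (c_1 + \sum_{i=2}^n c_{1i}) & c_{12} & \cdots & c_{1n} \\ c_{12} & - (c_2 + c_{12} + \sum_{i=3}^n c_{2i}) & \cdots & c_{2n} \\ \vdots & & \ddots & \vdots \\ c_{1n} & c_{2n} & \cdots & - (c_n + \sum_{i=1}^{n-1} c_{in}) \end{bmatrix} \succ 0 \right\}.$$ Specifically, using the variable ordering $(c_{12},c_{13},\ldots,c_{n-1,n},c_1,\ldots,c_n)$, $$\mathcal{R}_F = \bigcup_{g\in\mathfrak{G}} g\cdot\mathcal{S},$$ where $\mathfrak{G}\subset GL_{n(n+1)/2}(\mathbb{R})$ is the matrix group $$\mathfrak{G} = \{\mathrm{Diag}(x_1x_2,\ldots,x_1x_n,x_2x_3,\ldots,x_2x_n,\ldots,x_{n-1}x_n,x_1,\ldots,x_n) : x\in\{-1,+1\}^n\}.$$ Moreover, $\mathfrak{G}$ is isomorphic to $\underbrace{\mathbb{Z}_2\times\cdots\times\mathbb{Z}_2}_{n}$.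
   Context: $\mathrm{Sym}_n(\mathbb{R})$ is the space of real symmetric $n\times n$ matrices; $C=(c_{ij})$ with $c_{ij}=c_{ji}$, $c=(c_1,\ldots,c_n)^T$, and $\succ 0$ means positive definite (so spectrahedra here are the open sets cut out by $\succ 0$). The list $F$ defines the feasible set $\{-1,+1\}^n$ of the binary quadratic program $\min_{x\in\mathbb{R}^n} x^TCx+2c^Tx$ subject to $x_i^2-1=0$, $i=1,\ldots,n$. SDP exact region: for a list $F=(f_1,\ldots,f_m)$ of real polynomials of degree at most $2$ in $n$ variables, write $f_i(x) = x^TA_ix + 2a_i^Tx + \alpha_i$ with $A_i \in \mathrm{Sym}_n(\mathbb{R})$, $a_i\in\mathbb{R}^n$, $\alpha_i\in\mathbb{R}$, let $\mathcal{V}_{\mathbb{R}}(F)$ be the set of common real zeros of the $f_i$, and put $H(\lambda) = C - \sum_{i=1}^m\lambda_iA_i$ for $\lambda\in\mathbb{R}^m$. Then $$\mathcal{R}_F = \Big\{(C,c)\in \mathrm{Sym}_n(\mathbb{R})\times\mathbb{R}^n : H(\lambda)\succ 0 \text{ and } c - \sum_{i=1}^m\lambda_ia_i + H(\lambda)x = 0 \text{ for some } x\in\mathcal{V}_{\mathbb{R}}(F),\ \lambda\in\mathbb{R}^m\Big\}.$$ The diagonal entries $c_{11},\ldots,c_{nn}$ of $C$ do not enter the conditions; an element $g\in\mathfrak{G}$ acts on $(C,c)$ by matrix-vector multiplication on the coordinate vector $(c_{12},\ldots,c_{1n},c_{23},\ldots,c_{2n},\ldots,c_{n-1,n},c_1,\ldots,c_n)$,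 leaving the diagonal entries of $C$ unchanged. *)

theory Defs
  imports
    "Jordan_Normal_Form.Matrix"
    "HOL-Algebra.Elementary_Groups"
    "HOL-Algebra.Product_Groups"
begin

(* Vectors and matrices are those of Jordan_Normal_Form, hence indexed from 0:
   the entry c_{ij} of the mathematical text is C $$ (i - 1, j - 1). *)

definition sym_mats :: "nat \<Rightarrow> real mat set" where
  "sym_mats n = {C \<in> carrier_mat n n. transpose_mat C = C}"

definition pos_def :: "nat \<Rightarrow> real mat \<Rightarrow> bool" where
  "pos_def n M \<longleftrightarrow> M \<in> sym_mats n \<and>
     (\<forall>v \<in> carrier_vec n. v \<noteq> 0\<^sub>v n \<longrightarrow> v \<bullet> (M *\<^sub>v v) > 0)"

definition sym_vec_space :: "nat \<Rightarrow> (real mat \<times> real vec) set" where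
  "sym_vec_space n = sym_mats n \<times> carrier_vec n"

subsection \<open>The SDP exact region\<close>

(* Real polynomials are identified with the polynomial functions they induce on R^n.
   quad_form_of n f A a \<alpha> says that f is the polynomial x^T A x + 2 a^T x + \<alpha> with A
   symmetric; A, a and \<alpha> are determined by f (lemma quad_form_of_unique). *)

definition quad_form_of ::
    "nat \<Rightarrow> (real vec \<Rightarrow> real) \<Rightarrow> real mat \<Rightarrow> real vec \<Rightarrow> real \<Rightarrow> bool" where
  "quad_form_of n f A a \<alpha> \<longleftrightarrow> A \<in> sym_mats n \<and> a \<in> carrier_vec n \<and>
     (\<forall>x \<in> carrier_vec n. f x = x \<bullet> (A *\<^sub>v x) + 2 * (a \<bullet> x) + \<alpha>)"

definition real_variety :: "nat \<Rightarrow> (real vec \<Rightarrow> real) list \<Rightarrow> real vec set" where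
  "real_variety n F = {x \<in> carrier_vec n. \<forall>f \<in> set F. f x = 0}"

(* H(lambda) = C - sum_i lambda_i A_i; the multipliers are written \<mu>, \<lambda> being binder syntax. *)
definition H_matrix :: "nat \<Rightarrow> nat \<Rightarrow> (nat \<Rightarrow> real mat) \<Rightarrow> real mat \<Rightarrow> real vec \<Rightarrow> real mat" where
  "H_matrix n m A C \<mu> = mat n n (\<lambda>(r, s). C $$ (r, s) - (\<Sum>i<m. \<mu> $ i * A i $$ (r, s)))"

definition sdp_exact_region ::
    "nat \<Rightarrow> (real vec \<Rightarrow> real) list \<Rightarrow> (real mat \<times> real vec) set" where
  "sdp_exact_region n F = {(C, c). (C, c) \<in> sym_vec_space n \<and>
     (\<exists>A a \<alpha>. (\<forall>i < length F. quad_form_of n (F ! i) (A i) (a i) (\<alpha> i)) \<and>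
       (\<exists>x \<in> real_variety n F. \<exists>\<mu> \<in> carrier_vec (length F).
          pos_def n (H_matrix n (length F) A C \<mu>) \<and>
          vec n (\<lambda>r. c $ r - (\<Sum>i<length F. \<mu> $ i * a i $ r))
            + H_matrix n (length F) A C \<mu> *\<^sub>v x = 0\<^sub>v n))}"

definition binary_polys :: "nat \<Rightarrow> (real vec \<Rightarrow> real) list" where
  "binary_polys n = map (\<lambda>i x. (x $ i)\<^sup>2 - 1) [0..<n]"

subsection \<open>Spectrahedra and linear transformations in the space of pairs\<close>

(* Open spectrahedra: the solution sets of a strict linear matrix inequality in the
   entries of C and c.  Only the entries C_{ij} with i \<le> j are used as coordinates. *)

definition spectrahedron :: "nat \<Rightarrow> (real mat \<times> real vec) set \<Rightarrow> bool" where
  "spectrahedron n X \<longleftrightarrow> (\<exists>N P0 P Q.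
     P0 \<in> sym_mats N \<and> (\<forall>i j. P i j \<in> sym_mats N) \<and> (\<forall>i. Q i \<in> sym_mats N) \<and>
     X = {(C, c). (C, c) \<in> sym_vec_space n \<and>
       pos_def N (mat N N (\<lambda>(r, s). P0 $$ (r, s)
         + (\<Sum>i<n. \<Sum>j\<in>{i..<n}. C $$ (i, j) * P i j $$ (r, s))
         + (\<Sum>i<n. c $ i * Q i $$ (r, s))))})"

definition invertible_linear ::
    "nat \<Rightarrow> (real mat \<times> real vec \<Rightarrow> real mat \<times> real vec) \<Rightarrow> bool" where
  "invertible_linear n T \<longleftrightarrow> bij_betw T (sym_vec_space n) (sym_vec_space n) \<and>
     (\<forall>C c D d. (C, c) \<in> sym_vec_space n \<longrightarrow> (D, d) \<in> sym_vec_space n \<longrightarrow>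
        T (C + D, c + d) = (fst (T (C, c)) + fst (T (D, d)), snd (T (C, c)) + snd (T (D, d)))) \<and>
     (\<forall>t C c. (C, c) \<in> sym_vec_space n \<longrightarrow>
        T (t \<cdot>\<^sub>m C, t \<cdot>\<^sub>v c) = (t \<cdot>\<^sub>m fst (T (C, c)), t \<cdot>\<^sub>v snd (T (C, c))))"

definition S_matrix :: "nat \<Rightarrow> real mat \<Rightarrow> real vec \<Rightarrow> real mat" where
  "S_matrix n C c = mat n n (\<lambda>(i, j).
     if i = j then - (c $ i + (\<Sum>k \<in> {..<n} - {i}. C $$ (i, k))) else C $$ (i, j))"

definition S_set :: "nat \<Rightarrow> (real mat \<times> real vec) set" where
  "S_set n = {(C, c). (C, c) \<in> sym_vec_space n \<and> pos_def n (S_matrix n C c)}"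

subsection \<open>The sign group and its action\<close>

definition upper_pairs :: "nat \<Rightarrow> (nat \<times> nat) list" where
  "upper_pairs n = [(i, j). i \<leftarrow> [0..<n], j \<leftarrow> [Suc i..<n]]"

(* (c_{12},...,c_{1n},c_{23},...,c_{n-1,n},c_1,...,c_n) *)
definition coord_vec :: "nat \<Rightarrow> real mat \<times> real vec \<Rightarrow> real vec" where
  "coord_vec n = (\<lambda>(C, c).
     vec_of_list (map (\<lambda>ij. C $$ ij) (upper_pairs n) @ map (\<lambda>i. c $ i) [0..<n]))"

(* The pair with the diagonal of C whose coordinate vector is g times that of (C, c);
   it exists and is unique by lemma act_ex1. *)
definition act :: "nat \<Rightarrow> real mat \<Rightarrow> real mat \<times> real vec \<Rightarrow> real mat \<times> real vec" where
  "act n g p = (THE q. q \<in> sym_vec_space n \<and> (\<forall>i<n. fst q $$ (i, i) = fst p $$ (i, i)) \<and>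
     coord_vec n q = g *\<^sub>v coord_vec n p)"

definition Diag :: "real list \<Rightarrow> real mat" where
  "Diag xs = mat (length xs) (length xs) (\<lambda>(i, j). if i = j then xs ! i else 0)"

definition sign_group :: "nat \<Rightarrow> real mat set" where
  "sign_group n =
     {Diag (map (\<lambda>(i, j). x $ i * x $ j) (upper_pairs n) @ map (\<lambda>i. x $ i) [0..<n]) | x.
        x \<in> carrier_vec n \<and> (\<forall>i<n. x $ i \<in> {-1, 1})}"

definition GL :: "nat \<Rightarrow> real mat monoid" where
  "GL N = units_of (ring_mat TYPE(real) N ())"

subsection \<open>Well-definedness\<close>

lemma sym_mats_entry:
  assumes "A \<in> sym_mats n" "i < n" "j < n"
  shows "A $$ (i, j) = A $$ (j, i)"
  using assms unfolding sym_mats_def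
  by (metis (mono_tags, lifting) carrier_matD(1) carrier_matD(2) index_transpose_mat(1) mem_Collect_eq)

lemma quad_unit:
  fixes A :: "real mat" and s t :: real
  assumes A: "A \<in> carrier_mat n n" and a: "a \<in> carrier_vec n" and ij: "i < n" "j < n"
  defines "x \<equiv> s \<cdot>\<^sub>v unit_vec n i + t \<cdot>\<^sub>v unit_vec n j"
  shows "x \<bullet> (A *\<^sub>v x) + 2 * (a \<bullet> x) =
    s * s * A $$ (i, i) + s * t * (A $$ (i, j) + A $$ (j, i)) + t * t * A $$ (j, j)
      + 2 * (s * a $ i + t * a $ j)"
proof -
  let ?u = "unit_vec n i" and ?v = "unit_vec n j"
  have Au: "A *\<^sub>v ?u = col A i" and Av: "A *\<^sub>v ?v = col A j"
    using A ij by auto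
  have c: "col A i \<in> carrier_vec n" "col A j \<in> carrier_vec n"
    using A by auto
  have Ax: "A *\<^sub>v x = s \<cdot>\<^sub>v col A i + t \<cdot>\<^sub>v col A j"
    unfolding x_def using A ij
    by (simp add: mult_add_distrib_mat_vec[of A n n] mult_mat_vec[of A n n] Au Av)
  have "x \<bullet> (A *\<^sub>v x) = s * (s * A $$ (i, i) + t * A $$ (i, j))
      + t * (s * A $$ (j, i) + t * A $$ (j, j))"
    unfolding Ax unfolding x_def using A ij c
    by (simp add: add_scalar_prod_distrib[of _ n] scalar_prod_add_distrib[of _ n] algebra_simps)
  moreover have "a \<bullet> x = s * a $ i + t * a $ j"
    unfolding x_def using a ij
    by (simp add: scalar_prod_add_distrib[of _ n])
  ultimately show ?thesis
    by (simp add: algebra_simps)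
qed

lemma quad_form_of_unique:
  assumes 1: "quad_form_of n f A a \<alpha>" and 2: "quad_form_of n f B b \<beta>"
  shows "A = B \<and> a = b \<and> \<alpha> = \<beta>"
proof -
  have A: "A \<in> carrier_mat n n" "B \<in> carrier_mat n n" "a \<in> carrier_vec n" "b \<in> carrier_vec n"
    using 1 2 by (auto simp: quad_form_of_def sym_mats_def)
  have eq: "x \<bullet> (A *\<^sub>v x) + 2 * (a \<bullet> x) + \<alpha> = x \<bullet> (B *\<^sub>v x) + 2 * (b \<bullet> x) + \<beta>"
    if "x \<in> carrier_vec n" for x
    using 1 2 that unfolding quad_form_of_def by metis
  have \<alpha>: "\<alpha> = \<beta>"
    using eq[of "0\<^sub>v n"] A by auto
  have main: "s * s * A $$ (i, i) + s * t * (A $$ (i, j) + A $$ (j, i)) + t * t * A $$ (j, j)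
      + 2 * (s * a $ i + t * a $ j)
    = s * s * B $$ (i, i) + s * t * (B $$ (i, j) + B $$ (j, i)) + t * t * B $$ (j, j)
      + 2 * (s * b $ i + t * b $ j)" if "i < n" "j < n" for i j and s t :: real
    using eq[of "s \<cdot>\<^sub>v unit_vec n i + t \<cdot>\<^sub>v unit_vec n j"] \<alpha>
      quad_unit[OF A(1) A(3) that, of s t] quad_unit[OF A(2) A(4) that, of s t] by simp
  have lin: "a $ i = b $ i" and diag: "A $$ (i, i) = B $$ (i, i)" if "i < n" for i
    using main[OF that that, of 1 0] main[OF that that, of "-1" 0] by auto
  have "A $$ (i, j) = B $$ (i, j)" if ij: "i < n" "j < n" for i j
    using main[OF ij, of 1 1] lin[OF ij(1)] lin[OF ij(2)] diag[OF ij(1)] diag[OF ij(2)]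
      sym_mats_entry[of A n i j] sym_mats_entry[of B n i j] 1 2 ij
    by (simp add: quad_form_of_def)
  then have "A = B"
    using A by (intro eq_matI) auto
  moreover have "a = b"
    using A lin by (intro eq_vecI) auto
  ultimately show ?thesis
    using \<alpha> by simp
qed

lemma set_upper_pairs: "set (upper_pairs n) = {(i, j). i < j \<and> j < n}"
  by (force simp: upper_pairs_def)

lemma distinct_upper_pairs: "distinct (upper_pairs n)"
proof -
  have "distinct (concat (map (\<lambda>i. map (Pair i) [Suc i..<n]) [0..<m]))" for m
    by (induction m) (auto simp: distinct_map inj_on_def)
  then show ?thesis
    by (simp add: upper_pairs_def)
qed

lemma length_upper_pairs: "length (upper_pairs n) + n = n * (n + 1) div 2"
proof -
  have *: "length (upper_pairs n) = card {(i, j). i < j \<and> j < n}"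
    using distinct_card[OF distinct_upper_pairs, of n] by (simp add: set_upper_pairs)
  have "{(i, j). i < j \<and> j < n} = prod.swap ` (SIGMA j:{..<n}. {..<j})"
    by (auto simp: image_iff)
  then have "card {(i, j). i < j \<and> j < n} = card (SIGMA j:{..<n}. {..<j})"
    by (simp add: card_image)
  also have "\<dots> = (\<Sum>j<n. j)"
    by simp
  also have "(\<Sum>j<n. j) + n = n * (n + 1) div 2"
    by (induction n) auto
  finally show ?thesis
    using * \<open>(\<Sum>j<n. j) + n = n * (n + 1) div 2\<close> by simp
qed

lemma dim_coord_vec: "dim_vec (coord_vec n p) = n * (n + 1) div 2"
  by (cases p) (simp add: coord_vec_def length_upper_pairs)

lemma act_ex1:
  assumes p: "p \<in> sym_vec_space n"
    and g: "g \<in> carrier_mat (n * (n + 1) div 2) (n * (n + 1) div 2)"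
  shows "\<exists>!q. q \<in> sym_vec_space n \<and> (\<forall>i<n. fst q $$ (i, i) = fst p $$ (i, i)) \<and>
     coord_vec n q = g *\<^sub>v coord_vec n p"
proof (rule ex_ex1I)
  define us where "us = upper_pairs n"
  define w where "w = list_of_vec (g *\<^sub>v coord_vec n p)"
  have lw: "length w = length us + n"
    using g by (simp add: w_def us_def length_upper_pairs)
  have vw: "vec_of_list w = g *\<^sub>v coord_vec n p"
    by (simp add: w_def vec_list)
  define h where "h = (\<lambda>ij. the (map_of (zip us (take (length us) w)) ij))"
  define C where "C = mat n n (\<lambda>(i, j). if i = j then fst p $$ (i, i) else h (min i j, max i j))"
  define c where "c = vec n (\<lambda>i. w ! (length us + i))"
  have "C \<in> sym_mats n"
    unfolding sym_mats_def C_def by (auto intro!: eq_matI simp: min.commute max.commute)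
  then have 1: "(C, c) \<in> sym_vec_space n"
    by (simp add: sym_vec_space_def c_def)
  have hm: "map h us = take (length us) w"
    using lw distinct_upper_pairs[of n]
    by (intro nth_equalityI) (auto simp: h_def us_def map_of_zip_nth)
  have "map (\<lambda>ij. C $$ ij) us = map h us"
    by (auto simp: us_def set_upper_pairs C_def)
  moreover have "map (\<lambda>i. c $ i) [0..<n] = drop (length us) w"
    using lw by (intro nth_equalityI) (auto simp: c_def)
  ultimately have "coord_vec n (C, c) = vec_of_list w"
    unfolding coord_vec_def prod.case us_def[symmetric] hm by simp
  with 1 vw show "\<exists>q. q \<in> sym_vec_space n \<and> (\<forall>i<n. fst q $$ (i, i) = fst p $$ (i, i)) \<and>
     coord_vec n q = g *\<^sub>v coord_vec n p"
    by (intro exI[of _ "(C, c)"]) (auto simp: C_def)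
next
  fix q q'
  assume q: "q \<in> sym_vec_space n \<and> (\<forall>i<n. fst q $$ (i, i) = fst p $$ (i, i)) \<and>
     coord_vec n q = g *\<^sub>v coord_vec n p"
    and q': "q' \<in> sym_vec_space n \<and> (\<forall>i<n. fst q' $$ (i, i) = fst p $$ (i, i)) \<and>
     coord_vec n q' = g *\<^sub>v coord_vec n p"
  obtain C c D d where eq: "q = (C, c)" "q' = (D, d)"
    by (metis surj_pair)
  have mem: "C \<in> sym_mats n" "D \<in> sym_mats n" "c \<in> carrier_vec n" "d \<in> carrier_vec n"
    using q q' by (auto simp: eq sym_vec_space_def)
  have "coord_vec n q = coord_vec n q'"
    using q q' by simp
  then have "list_of_vec (coord_vec n q) = list_of_vec (coord_vec n q')"
    by simp
  then have l: "map (\<lambda>ij. C $$ ij) (upper_pairs n) = map (\<lambda>ij. D $$ ij) (upper_pairs n)"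
    and r: "map (\<lambda>i. c $ i) [0..<n] = map (\<lambda>i. d $ i) [0..<n]"
    by (simp_all add: eq coord_vec_def list_vec del: map_eq_conv)
  have up: "C $$ (i, j) = D $$ (i, j)" if "i < j" "j < n" for i j
    using l that by (auto simp: set_upper_pairs)
  have "C $$ (i, j) = D $$ (i, j)" if "i < n" "j < n" for i j
    using up[of i j] up[of j i] q q' that sym_mats_entry[OF mem(1) that]
      sym_mats_entry[OF mem(2) that] by (cases i j rule: linorder_cases) (auto simp: eq)
  moreover have "c $ i = d $ i" if "i < n" for i
    using r that by simp
  ultimately show "q = q'"
    using mem by (auto simp: eq sym_mats_def intro!: eq_matI eq_vecI)
qed

end

theory Submission
  imports Defs
begin

text \<open>
  Write \<open>D\<^sub>x\<close> for the diagonal matrix of a sign vector \<open>x\<close>. The quadratic form of \<open>x\<^sub>i\<^sup>2 - 1\<close> is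
  the diagonal matrix unit \<open>E\<^sub>i\<^sub>i\<close>, with no linear part, so \<open>H(\<mu>)\<close> is \<open>C\<close> with \<open>\<mu>\<close> subtracted from
  its diagonal, and the common zeros are the sign vectors. For a fixed sign vector \<open>x\<close> the
  equation \<open>c + H(\<mu>) x = 0\<close> determines \<open>\<mu>\<close>, because its row \<open>i\<close> reads
  \<open>H(\<mu>)\<^sub>i\<^sub>i = - x\<^sub>i (c\<^sub>i + \<Sum>\<^sub>k\<^sub>\<noteq>\<^sub>i C\<^sub>i\<^sub>k x\<^sub>k)\<close>. Conjugating by \<open>D\<^sub>x\<close> preserves positive definiteness and
  the diagonal, so \<open>x\<close> certifies exactness of \<open>(C, c)\<close> if and only if the matrix with
  off-diagonal entries \<open>x\<^sub>i x\<^sub>j C\<^sub>i\<^sub>j\<close> and diagonal entries \<open>- (x\<^sub>i c\<^sub>i + \<Sum>\<^sub>k\<^sub>\<noteq>\<^sub>i x\<^sub>i x\<^sub>k C\<^sub>i\<^sub>k)\<close> is positive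
  definite. That matrix is the one that defines \<open>S\<close>, taken at the switched pair
  \<open>(D\<^sub>x C D\<^sub>x, D\<^sub>x c)\<close>; see \<open>stationary_iff_S_matrix\<close> and \<open>exact_multiplier_iff\<close>.

  Switching is a linear involution, so the pairs certified by \<open>x\<close> form the image of \<open>S\<close> under
  switching by \<open>x\<close>, and since switching fixes the diagonal of \<open>C\<close> it is the action of the element of
  the sign group given by \<open>x\<close> (\<open>act_sign_diag\<close>). The pulled-back matrix is linear in the entries of
  \<open>(C, c)\<close>, so every piece is a spectrahedron (\<open>spectrahedron_switch\<close>). The pieces are pairwise
  different because the pair \<open>(0, -x)\<close> lies in the piece of \<open>x\<close> only (\<open>switch_image_eq_imp_eq\<close>).

  Finally \<open>x\<close> can be read off from the last \<open>n\<close> diagonal entries of its group element, and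
  componentwise multiplication of signs is addition of exponents of \<open>-1\<close> modulo 2. This gives an
  injective homomorphism from the \<open>n\<close>-th power of the integers modulo 2 to \<open>GL\<close> with image the sign
  group (\<open>sign_group_structure\<close>), whence the subgroup property, the isomorphism and the number
  \<open>2\<^sup>n\<close> of elements.
\<close>

section \<open>Sign vectors and switching\<close>

lemma mult_if_zero:
  fixes a b :: "'a :: mult_zero"
  shows "(if P then a else 0) * b = (if P then a * b else 0)"
    and "b * (if P then a else 0) = (if P then b * a else 0)"
  by simp_all

definition sign_vecs :: "nat \<Rightarrow> real vec set" where
  "sign_vecs n = {x \<in> carrier_vec n. \<forall>i<n. x $ i \<in> {-1, 1}}"

text \<open>
  This is the congruence \<open>D\<^sub>x M D\<^sub>x\<close>, written entrywise so that no diagonal matrix product has to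
  be unfolded.
\<close>
definition signed_mat :: "nat \<Rightarrow> real vec \<Rightarrow> real mat \<Rightarrow> real mat" where
  "signed_mat n x M = mat n n (\<lambda>(i, j). x $ i * x $ j * M $$ (i, j))"

text \<open>
  The name is that of the corresponding symmetry of the cut polytope; a sign vector \<open>x\<close> leaves the
  diagonal of the matrix unchanged since \<open>x\<^sub>i\<^sup>2 = 1\<close>.
\<close>
definition switch :: "nat \<Rightarrow> real vec \<Rightarrow> real mat \<times> real vec \<Rightarrow> real mat \<times> real vec" where
  "switch n x p = (signed_mat n x (fst p), vec n (\<lambda>i. x $ i * snd p $ i))"

lemma sign_vecs_square:
  assumes "x \<in> sign_vecs n" "i < n"
  shows "x $ i * x $ i = 1"
  using assms by (auto simp: sign_vecs_def)

lemma sign_vecs_square_left: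
  assumes "x \<in> sign_vecs n" "i < n"
  shows "x $ i * (x $ i * t) = t"
  using sign_vecs_square[OF assms] by (simp flip: mult.assoc)

lemma signed_mat_carrier [simp]: "signed_mat n x M \<in> carrier_mat n n"
  by (simp add: signed_mat_def)

lemma signed_mat_sym: "M \<in> sym_mats n \<Longrightarrow> signed_mat n x M \<in> sym_mats n"
  using sym_mats_entry[of M n]
  by (auto simp: sym_mats_def signed_mat_def mult.commute intro!: eq_matI)

lemma signed_mat_signed_mat:
  assumes "x \<in> sign_vecs n" "M \<in> carrier_mat n n"
  shows "signed_mat n x (signed_mat n x M) = M"
  using assms
  by (intro eq_matI) (auto simp: signed_mat_def sign_vecs_square_left mult_ac)

lemma switch_in_space: "p \<in> sym_vec_space n \<Longrightarrow> switch n x p \<in> sym_vec_space n"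
  by (auto simp: sym_vec_space_def switch_def signed_mat_sym)

lemma switch_switch:
  assumes "x \<in> sign_vecs n" "p \<in> sym_vec_space n"
  shows "switch n x (switch n x p) = p"
  using assms
  by (cases p) (auto simp: switch_def sym_vec_space_def sym_mats_def signed_mat_signed_mat
      sign_vecs_square_left intro!: eq_vecI)

lemma sum_quadratic:
  fixes M :: "real mat"
  assumes "M \<in> carrier_mat n n" "v \<in> carrier_vec n"
  shows "v \<bullet> (M *\<^sub>v v) = (\<Sum>i<n. \<Sum>j<n. v $ i * M $$ (i, j) * v $ j)"
  using assms by (auto simp: scalar_prod_def sum_distrib_left mult_ac lessThan_atLeast0 intro!: sum.cong)

text \<open>
  The value of the form of \<open>D\<^sub>x M D\<^sub>x\<close> at \<open>v\<close> is the value of the form of \<open>M\<close> at \<open>D\<^sub>x v\<close>, and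
  \<open>D\<^sub>x\<close> is invertible.
\<close>
lemma pos_def_signed_mat:
  assumes x: "x \<in> sign_vecs n" and M: "pos_def n M"
  shows "pos_def n (signed_mat n x M)"
  unfolding pos_def_def
proof (intro conjI ballI impI)
  show "signed_mat n x M \<in> sym_mats n"
    using M by (simp add: pos_def_def signed_mat_sym)
  have carr: "M \<in> carrier_mat n n"
    using M by (simp add: pos_def_def sym_mats_def)
  fix v :: "real vec"
  assume v: "v \<in> carrier_vec n" "v \<noteq> 0\<^sub>v n"
  define w where "w = vec n (\<lambda>i. x $ i * v $ i)"
  have w: "w \<in> carrier_vec n"
    by (simp add: w_def)
  have "w \<noteq> 0\<^sub>v n"
  proof
    assume "w = 0\<^sub>v n"
    then have "x $ i * v $ i = 0" if "i < n" for i
      using that by (metis index_vec index_zero_vec(1) w_def)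
    then have "v $ i = 0" if "i < n" for i
      using that sign_vecs_square[OF x that] by fastforce
    then show False
      using v by (auto intro!: eq_vecI)
  qed
  then have "0 < w \<bullet> (M *\<^sub>v w)"
    using M w by (simp add: pos_def_def)
  also have "w \<bullet> (M *\<^sub>v w) = v \<bullet> (signed_mat n x M *\<^sub>v v)"
    unfolding sum_quadratic[OF carr w] sum_quadratic[OF signed_mat_carrier v(1)]
    by (auto simp: signed_mat_def w_def mult_ac intro!: sum.cong)
  finally show "0 < v \<bullet> (signed_mat n x M *\<^sub>v v)" .
qed

lemma pos_def_signed_mat_iff:
  assumes "x \<in> sign_vecs n" "M \<in> carrier_mat n n"
  shows "pos_def n (signed_mat n x M) \<longleftrightarrow> pos_def n M"
  using pos_def_signed_mat[OF assms(1)] signed_mat_signed_mat[OF assms] by metis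

lemma pos_def_diagonal_entry:
  assumes M: "pos_def n M" and i: "i < n"
  shows "0 < M $$ (i, i)"
proof -
  have carr: "M \<in> carrier_mat n n"
    using M by (simp add: pos_def_def sym_mats_def)
  have "unit_vec n i \<noteq> (0\<^sub>v n :: real vec)"
    using i by (metis index_unit_vec(2) index_zero_vec(1) zero_neq_one)
  then have "0 < unit_vec n i \<bullet> (M *\<^sub>v unit_vec n i)"
    using M by (simp add: pos_def_def)
  then show ?thesis
    using carr i by simp
qed

text \<open>
  As switching is an involution, images are preimages: this turns the pieces of the region into
  explicit matrix conditions.
\<close>
lemma in_switch_image_iff:
  assumes "x \<in> sign_vecs n"
  shows "p \<in> switch n x ` S_set n \<longleftrightarrow>
    p \<in> sym_vec_space n \<and> pos_def n (case_prod (S_matrix n) (switch n x p))"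
proof -
  have S: "q \<in> S_set n \<longleftrightarrow> q \<in> sym_vec_space n \<and> pos_def n (case_prod (S_matrix n) q)" for q
    by (auto simp: S_set_def)
  show ?thesis
    using S switch_switch[OF assms] switch_in_space by (metis image_iff)
qed

lemma S_matrix_switch:
  "case_prod (S_matrix n) (switch n x (C, c)) = mat n n (\<lambda>(i, j).
     if i = j then - (x $ i * c $ i + (\<Sum>k \<in> {..<n} - {i}. x $ i * x $ k * C $$ (i, k)))
     else x $ i * x $ j * C $$ (i, j))"
  by (auto simp: switch_def S_matrix_def signed_mat_def intro!: eq_matI)

section \<open>The exact region of the binary program\<close>

lemma real_variety_binary: "real_variety n (binary_polys n) = sign_vecs n"
  by (auto simp: real_variety_def binary_polys_def sign_vecs_def power2_eq_1_iff)

lemma quad_form_square_minus_1: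
  assumes "i < n"
  shows "quad_form_of n (\<lambda>x. (x $ i)\<^sup>2 - 1)
    (mat n n (\<lambda>(r, s). if r = i \<and> s = i then 1 else 0)) (0\<^sub>v n) (-1)"
proof -
  have *: "(\<Sum>k<n. \<Sum>j<n. v $ k * (if k = i \<and> j = i then 1 else 0) * v $ j) = (v $ i)\<^sup>2"
    for v :: "real vec"
  proof -
    have "(\<Sum>k<n. \<Sum>j<n. v $ k * (if k = i \<and> j = i then 1 else 0) * v $ j)
        = (\<Sum>k<n. if k = i then \<Sum>j<n. if j = i then v $ i * v $ j else 0 else 0)"
      using assms by (intro sum.cong) (auto simp: mult_if_zero)
    then show ?thesis
      using assms by (simp add: power2_eq_square)
  qed
  show ?thesis
    unfolding quad_form_of_def
    by (auto simp: sym_mats_def sum_quadratic[of _ n] * intro!: eq_matI)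
qed

text \<open>
  The matrix \<open>H(\<mu>)\<close> of the binary program.
\<close>
definition shifted_mat :: "nat \<Rightarrow> real mat \<Rightarrow> real vec \<Rightarrow> real mat" where
  "shifted_mat n C \<mu> = mat n n (\<lambda>(i, j). C $$ (i, j) - (if i = j then \<mu> $ i else 0))"

text \<open>
  The region quantifies over all ways of writing the polynomials as quadratic forms; by uniqueness
  of the coefficients only the diagonal matrix units with zero linear part remain.
\<close>
lemma sdp_exact_region_binary:
  "(C, c) \<in> sdp_exact_region n (binary_polys n) \<longleftrightarrow> (C, c) \<in> sym_vec_space n \<and>
     (\<exists>x \<in> sign_vecs n. \<exists>\<mu> \<in> carrier_vec n. pos_def n (shifted_mat n C \<mu>) \<and>
        c + shifted_mat n C \<mu> *\<^sub>v x = 0\<^sub>v n)"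
proof -
  define E where "E = (\<lambda>i. mat n n (\<lambda>(r, s). if r = i \<and> s = i then 1 else (0::real)))"
  have form: "quad_form_of n (binary_polys n ! i) (E i) (0\<^sub>v n) (-1)" if "i < n" for i
    using quad_form_square_minus_1[OF that] that by (simp add: binary_polys_def E_def)
  have len: "length (binary_polys n) = n"
    by (simp add: binary_polys_def)
  have H: "H_matrix n n A C \<mu> = shifted_mat n C \<mu>" if A: "\<forall>i<n. A i = E i" for A \<mu>
  proof -
    have "(\<Sum>i<n. \<mu> $ i * A i $$ (r, s)) = (if r = s then \<mu> $ r else 0)"
      if "r < n" "s < n" for r s
    proof -
      have "(\<Sum>i<n. \<mu> $ i * A i $$ (r, s)) = (\<Sum>i<n. if i = r then if r = s then \<mu> $ r else 0 else 0)"
        using A that by (intro sum.cong) (auto simp: E_def)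
      then show ?thesis
        using that by simp
    qed
    then show ?thesis
      by (auto simp: H_matrix_def shifted_mat_def intro!: eq_matI)
  qed
  have g: "vec n (\<lambda>r. c $ r - (\<Sum>i<n. \<mu> $ i * a i $ r)) = c"
    if "\<forall>i<n. a i = 0\<^sub>v n" "c \<in> carrier_vec n" for a :: "nat \<Rightarrow> real vec" and \<mu> :: "real vec"
    using that by (intro eq_vecI) auto
  show ?thesis
  proof (cases "(C, c) \<in> sym_vec_space n")
    case True
    then have c: "c \<in> carrier_vec n"
      by (simp add: sym_vec_space_def)
    have "(C, c) \<in> sdp_exact_region n (binary_polys n) \<longleftrightarrow>
      (\<exists>A a \<alpha>. (\<forall>i<n. quad_form_of n (binary_polys n ! i) (A i) (a i) (\<alpha> i)) \<and>
       (\<exists>x \<in> sign_vecs n. \<exists>\<mu> \<in> carrier_vec n. pos_def n (H_matrix n n A C \<mu>) \<and>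
          vec n (\<lambda>r. c $ r - (\<Sum>i<n. \<mu> $ i * a i $ r)) + H_matrix n n A C \<mu> *\<^sub>v x = 0\<^sub>v n))"
      using True by (simp add: sdp_exact_region_def len real_variety_binary)
    also have "\<dots> \<longleftrightarrow> (\<exists>x \<in> sign_vecs n. \<exists>\<mu> \<in> carrier_vec n. pos_def n (shifted_mat n C \<mu>) \<and>
        c + shifted_mat n C \<mu> *\<^sub>v x = 0\<^sub>v n)" (is "?L \<longleftrightarrow> ?R")
    proof
      assume ?L
      then obtain A a \<alpha> x \<mu> where
        q: "\<forall>i<n. quad_form_of n (binary_polys n ! i) (A i) (a i) (\<alpha> i)"
        and x: "x \<in> sign_vecs n" "\<mu> \<in> carrier_vec n" "pos_def n (H_matrix n n A C \<mu>)"
          "vec n (\<lambda>r. c $ r - (\<Sum>i<n. \<mu> $ i * a i $ r)) + H_matrix n n A C \<mu> *\<^sub>v x = 0\<^sub>v n"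
        by blast
      have "\<forall>i<n. A i = E i" "\<forall>i<n. a i = 0\<^sub>v n"
        using q form quad_form_of_unique by blast+
      then have "pos_def n (shifted_mat n C \<mu>)" "c + shifted_mat n C \<mu> *\<^sub>v x = 0\<^sub>v n"
        using x(3,4) H g c by simp_all
      then show ?R
        using x(1,2) by blast
    next
      assume ?R
      then show ?L
        using form H[of E] g[of "\<lambda>_. 0\<^sub>v n"] c
        by (intro exI[of _ E] exI[of _ "\<lambda>_. 0\<^sub>v n"] exI[of _ "\<lambda>_. -1"]) simp
    qed
    finally show ?thesis
      using True by simp
  qed (simp add: sdp_exact_region_def)
qed

text \<open>
  Off the diagonal both matrices always agree. Multiplied by \<open>x\<^sub>i = \<plusminus>1\<close>, row \<open>i\<close> of the stationarity
  equation expresses the diagonal entry \<open>C\<^sub>i\<^sub>i - \<mu>\<^sub>i\<close> by the off-diagonal data, which is the agreement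
  of the \<open>i\<close>-th diagonal entries.
\<close>
lemma stationary_iff_S_matrix:
  assumes x: "x \<in> sign_vecs n" and c: "c \<in> carrier_vec n"
  shows "c + shifted_mat n C \<mu> *\<^sub>v x = 0\<^sub>v n \<longleftrightarrow>
    signed_mat n x (shifted_mat n C \<mu>) = case_prod (S_matrix n) (switch n x (C, c))"
proof -
  have row: "(c + shifted_mat n C \<mu> *\<^sub>v x) $ i =
      c $ i + (\<Sum>k \<in> {..<n} - {i}. x $ k * C $$ (i, k)) + x $ i * (C $$ (i, i) - \<mu> $ i)"
    if i: "i < n" for i
  proof -
    have "(c + shifted_mat n C \<mu> *\<^sub>v x) $ i
        = c $ i + (\<Sum>k<n. x $ k * (C $$ (i, k) - (if i = k then \<mu> $ i else 0)))"
      using x c i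
      by (auto simp: shifted_mat_def sign_vecs_def scalar_prod_def lessThan_atLeast0 mult.commute
          intro!: sum.cong)
    also have "(\<Sum>k<n. x $ k * (C $$ (i, k) - (if i = k then \<mu> $ i else 0))) =
        x $ i * (C $$ (i, i) - \<mu> $ i) + (\<Sum>k \<in> {..<n} - {i}. x $ k * C $$ (i, k))"
      using i by (subst sum.remove[of _ i]) (auto intro!: sum.cong)
    finally show ?thesis
      by simp
  qed
  have scale: "t + u + x $ i * d = 0 \<longleftrightarrow> d = - (x $ i * t + x $ i * u)" if "i < n" for i t u d
  proof -
    have "x $ i = 1 \<or> x $ i = -1"
      using x that by (auto simp: sign_vecs_def)
    then show ?thesis
      by (elim disjE) auto
  qed
  have "c + shifted_mat n C \<mu> *\<^sub>v x = 0\<^sub>v n \<longleftrightarrow>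
      (\<forall>i<n. (c + shifted_mat n C \<mu> *\<^sub>v x) $ i = 0)"
    using c by (auto simp: vec_eq_iff shifted_mat_def)
  also have "\<dots> \<longleftrightarrow> (\<forall>i<n. C $$ (i, i) - \<mu> $ i =
      - (x $ i * c $ i + x $ i * (\<Sum>k \<in> {..<n} - {i}. x $ k * C $$ (i, k))))"
    by (auto simp: row scale)
  also have "\<dots> \<longleftrightarrow> (\<forall>i<n. \<forall>j<n. signed_mat n x (shifted_mat n C \<mu>) $$ (i, j) =
      case_prod (S_matrix n) (switch n x (C, c)) $$ (i, j))"
    unfolding S_matrix_switch
    by (auto simp: signed_mat_def shifted_mat_def sum_distrib_left mult_ac sign_vecs_square_left[OF x])
  also have "\<dots> \<longleftrightarrow> signed_mat n x (shifted_mat n C \<mu>) = case_prod (S_matrix n) (switch n x (C, c))"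
    by (auto simp: mat_eq_iff signed_mat_def S_matrix_switch)
  finally show ?thesis .
qed

text \<open>
  The multiplier is eliminated here: every diagonal can be reached by a choice of \<open>\<mu>\<close>, so
  stationarity can always be met and only the positivity of the resulting form is left.
\<close>
lemma exact_multiplier_iff:
  assumes x: "x \<in> sign_vecs n" and c: "c \<in> carrier_vec n"
  shows "(\<exists>\<mu> \<in> carrier_vec n. pos_def n (shifted_mat n C \<mu>) \<and> c + shifted_mat n C \<mu> *\<^sub>v x = 0\<^sub>v n)
    \<longleftrightarrow> pos_def n (case_prod (S_matrix n) (switch n x (C, c)))" (is "?L \<longleftrightarrow> pos_def n ?S")
proof
  assume ?L
  then show "pos_def n ?S"
    using stationary_iff_S_matrix[OF x c] pos_def_signed_mat[OF x] by metis
next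
  assume S: "pos_def n ?S"
  \<comment> \<open>The value of \<open>\<mu>\<close> that stationarity forces.\<close>
  define \<mu> where "\<mu> = vec n (\<lambda>i. C $$ (i, i) - ?S $$ (i, i))"
  have "signed_mat n x (shifted_mat n C \<mu>) = ?S"
    unfolding S_matrix_switch using sign_vecs_square[OF x]
    by (intro eq_matI) (auto simp: signed_mat_def shifted_mat_def \<mu>_def S_matrix_switch)
  moreover have "shifted_mat n C \<mu> \<in> carrier_mat n n" "\<mu> \<in> carrier_vec n"
    by (simp_all add: shifted_mat_def \<mu>_def)
  ultimately show ?L
    using S stationary_iff_S_matrix[OF x c] pos_def_signed_mat_iff[OF x] by metis
qed

lemma sdp_exact_region_switch:
  "sdp_exact_region n (binary_polys n) = (\<Union>x \<in> sign_vecs n. switch n x ` S_set n)"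
proof -
  have "(C, c) \<in> sdp_exact_region n (binary_polys n) \<longleftrightarrow>
      (C, c) \<in> (\<Union>x \<in> sign_vecs n. switch n x ` S_set n)" for C c
  proof (cases "(C, c) \<in> sym_vec_space n")
    case True
    then have "c \<in> carrier_vec n"
      by (simp add: sym_vec_space_def)
    then show ?thesis
      using True exact_multiplier_iff by (simp add: sdp_exact_region_binary in_switch_image_iff)
  qed (simp add: sdp_exact_region_binary in_switch_image_iff)
  then show ?thesis
    by auto
qed

text \<open>
  The pair \<open>(0, -x)\<close> separates the pieces: switched by \<open>y\<close> it yields the diagonal matrix with
  entries \<open>y\<^sub>i x\<^sub>i\<close>, which is positive definite only for \<open>y = x\<close>.
\<close>
lemma switch_image_eq_imp_eq:
  assumes x: "x \<in> sign_vecs n" and y: "y \<in> sign_vecs n"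
    and eq: "switch n x ` S_set n = switch n y ` S_set n"
  shows "x = y"
proof -
  define p where "p = (0\<^sub>m n n :: real mat, - x)"
  have carr: "x \<in> carrier_vec n" "y \<in> carrier_vec n"
    using x y by (auto simp: sign_vecs_def)
  have S: "case_prod (S_matrix n) (switch n z p) = mat n n (\<lambda>(i, j). if i = j then z $ i * x $ i else 0)"
    for z
    unfolding p_def S_matrix_switch using carr by (intro eq_matI) auto
  have "case_prod (S_matrix n) (switch n x p) = 1\<^sub>m n"
    unfolding S using sign_vecs_square[OF x] by (intro eq_matI) auto
  moreover have "pos_def n (1\<^sub>m n)"
  proof -
    have "0 < v \<bullet> v" if "v \<in> carrier_vec n" "v \<noteq> 0\<^sub>v n" for v :: "real vec"
    proof -
      obtain i where i: "i < n" "v $ i \<noteq> 0"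
        using \<open>v \<in> carrier_vec n\<close> \<open>v \<noteq> 0\<^sub>v n\<close> by (auto simp: vec_eq_iff)
      then show ?thesis
        using that unfolding scalar_prod_def
        by (intro sum_pos2[of _ i]) (auto simp: zero_less_mult_iff linorder_neq_iff)
    qed
    then show ?thesis
      by (auto simp: pos_def_def sym_mats_def)
  qed
  moreover have "p \<in> sym_vec_space n"
    using carr by (auto simp: p_def sym_vec_space_def sym_mats_def)
  ultimately have "p \<in> switch n y ` S_set n"
    using in_switch_image_iff[OF x] by (simp flip: eq)
  then have "0 < case_prod (S_matrix n) (switch n y p) $$ (i, i)" if "i < n" for i
    using in_switch_image_iff[OF y] pos_def_diagonal_entry that by blast
  then have "0 < y $ i * x $ i" if "i < n" for i
    unfolding S using that by auto
  then have "x $ i = y $ i" if "i < n" for i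
    using x y that by (fastforce simp: sign_vecs_def)
  then show ?thesis
    using carr by (intro eq_vecI) auto
qed

section \<open>The pieces are spectrahedra\<close>

text \<open>
  A row of the defining matrix of \<open>S\<close> involves all \<open>C\<^sub>r\<^sub>k\<close> with \<open>k \<noteq> r\<close>, whereas a spectrahedron is
  given by a sum over the coordinates \<open>C\<^sub>i\<^sub>j\<close> with \<open>i \<le> j\<close>. This converts one into the other for a summand
  supported on the pairs that contain \<open>r\<close>.
\<close>
lemma sum_upper_pairs_through:
  fixes f :: "nat \<Rightarrow> nat \<Rightarrow> real"
  assumes r: "r < n" and zero: "\<And>i j. i \<le> j \<Longrightarrow> i = j \<or> (i \<noteq> r \<and> j \<noteq> r) \<Longrightarrow> f i j = 0"
  shows "(\<Sum>i<n. \<Sum>j\<in>{i..<n}. f i j) = (\<Sum>k \<in> {..<n} - {r}. f (min r k) (max r k))"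
proof -
  let ?h = "\<lambda>k. (min r k, max r k)"
  have "(\<Sum>i<n. \<Sum>j\<in>{i..<n}. f i j) = (\<Sum>(i, j) \<in> (SIGMA i:{..<n}. {i..<n}). f i j)"
    by (simp add: sum.Sigma)
  also have "\<dots> = (\<Sum>(i, j) \<in> ?h ` ({..<n} - {r}). f i j)"
  proof (rule sum.mono_neutral_right)
    show "\<forall>p \<in> (SIGMA i:{..<n}. {i..<n}) - ?h ` ({..<n} - {r}). (case p of (i, j) \<Rightarrow> f i j) = 0"
    proof
      fix p
      assume "p \<in> (SIGMA i:{..<n}. {i..<n}) - ?h ` ({..<n} - {r})"
      then obtain i j where p: "p = (i, j)"
        and ij: "i < n" "i \<le> j" "j < n" "(i, j) \<notin> ?h ` ({..<n} - {r})"
        by auto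
      have "i = j \<or> (i \<noteq> r \<and> j \<noteq> r)"
      proof (rule ccontr)
        assume "\<not> ?thesis"
        then have "(i, j) = ?h (if i = r then j else i)" "(if i = r then j else i) \<in> {..<n} - {r}"
          using ij by auto
        then show False
          using ij(4) by blast
      qed
      then show "(case p of (i, j) \<Rightarrow> f i j) = 0"
        using p ij zero by simp
    qed
  qed (use r in auto)
  also have "\<dots> = (\<Sum>k \<in> {..<n} - {r}. f (min r k) (max r k))"
    by (subst sum.reindex) (auto simp: inj_on_def min_def max_def split: if_splits)
  finally show ?thesis .
qed

text \<open>
  The coefficient matrix of \<open>C\<^sub>i\<^sub>j\<close>, \<open>i < j\<close>, is \<open>x\<^sub>i x\<^sub>j\<close> times the negative of the Laplacian of the edge
  \<open>ij\<close>: the entry \<open>C\<^sub>i\<^sub>j\<close> appears at \<open>(i, j)\<close> and \<open>(j, i)\<close> and is subtracted in rows \<open>i\<close> and \<open>j\<close> of the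
  diagonal. The coefficient of \<open>c\<^sub>i\<close> is \<open>- x\<^sub>i\<close> times the \<open>i\<close>-th diagonal matrix unit.
\<close>
lemma spectrahedron_switch:
  assumes x: "x \<in> sign_vecs n"
  shows "spectrahedron n (switch n x ` S_set n)"
proof -
  define P where "P = (\<lambda>i j. mat n n (\<lambda>(r, s). x $ i * x $ j *
      (if i = j then 0
       else if r = s then if r = i \<or> r = j then -1 else 0
       else if (r = i \<and> s = j) \<or> (r = j \<and> s = i) then 1 else 0)))"
  define Q where "Q = (\<lambda>i. mat n n (\<lambda>(r, s). if r = i \<and> s = i then - x $ i else 0))"
  have Psym: "P i j \<in> sym_mats n" for i j
    unfolding sym_mats_def P_def by (auto intro!: eq_matI)
  have Qsym: "Q i \<in> sym_mats n" for i
    unfolding sym_mats_def Q_def by (auto intro!: eq_matI)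
  have eq: "mat n n (\<lambda>(r, s). 0\<^sub>m n n $$ (r, s)
         + (\<Sum>i<n. \<Sum>j\<in>{i..<n}. C $$ (i, j) * P i j $$ (r, s))
         + (\<Sum>i<n. c $ i * Q i $$ (r, s))) = case_prod (S_matrix n) (switch n x (C, c))"
    if C: "C \<in> sym_mats n" for C c
  proof -
    have sym: "C $$ (min i j, max i j) = C $$ (i, j)" if "i < n" "j < n" for i j
      using sym_mats_entry[OF C that] by (simp add: min_def max_def)
    have P_entry: "P (min r k) (max r k) $$ (r, s) =
        x $ r * x $ k * (if r = s then -1 else if k = s then 1 else 0)"
      if "r < n" "s < n" "k < n" "r \<noteq> k" for r s k
      using that by (auto simp: P_def min_def max_def)
    have P_sum: "(\<Sum>i<n. \<Sum>j\<in>{i..<n}. C $$ (i, j) * P i j $$ (r, s)) =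
       (if r = s then - (\<Sum>k \<in> {..<n} - {r}. x $ r * x $ k * C $$ (r, k))
        else x $ r * x $ s * C $$ (r, s))" if rs: "r < n" "s < n" for r s
    proof -
      have "(\<Sum>i<n. \<Sum>j\<in>{i..<n}. C $$ (i, j) * P i j $$ (r, s)) =
          (\<Sum>k \<in> {..<n} - {r}. C $$ (min r k, max r k) * P (min r k) (max r k) $$ (r, s))"
        using rs by (intro sum_upper_pairs_through) (auto simp: P_def)
      also have "\<dots> = (\<Sum>k \<in> {..<n} - {r}.
          if r = s then - (x $ r * x $ k * C $$ (r, k))
          else if k = s then x $ r * x $ s * C $$ (r, s) else 0)"
        using rs by (intro sum.cong) (auto simp: sym P_entry)
      also have "\<dots> = (if r = s then - (\<Sum>k \<in> {..<n} - {r}. x $ r * x $ k * C $$ (r, k))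
        else x $ r * x $ s * C $$ (r, s))"
        using rs by (auto simp: sum_negf)
      finally show ?thesis .
    qed
    have Q_sum: "(\<Sum>i<n. c $ i * Q i $$ (r, s)) = (if r = s then - (x $ r * c $ r) else 0)"
      if rs: "r < n" "s < n" for r s
    proof -
      have "(\<Sum>i<n. c $ i * Q i $$ (r, s)) =
          (\<Sum>i<n. if i = r then if r = s then - (x $ r * c $ r) else 0 else 0)"
        using rs by (intro sum.cong) (auto simp: Q_def)
      then show ?thesis
        using rs by simp
    qed
    show ?thesis
      unfolding S_matrix_switch by (intro eq_matI) (auto simp: P_sum Q_sum)
  qed
  have "(C, c) \<in> switch n x ` S_set n \<longleftrightarrow> (C, c) \<in> sym_vec_space n \<and>
       pos_def n (mat n n (\<lambda>(r, s). 0\<^sub>m n n $$ (r, s)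
         + (\<Sum>i<n. \<Sum>j\<in>{i..<n}. C $$ (i, j) * P i j $$ (r, s))
         + (\<Sum>i<n. c $ i * Q i $$ (r, s))))" for C c
    using eq[of C c] by (auto simp only: in_switch_image_iff[OF x] sym_vec_space_def mem_Times_iff fst_conv)
  then have "switch n x ` S_set n = {(C, c). (C, c) \<in> sym_vec_space n \<and>
       pos_def n (mat n n (\<lambda>(r, s). 0\<^sub>m n n $$ (r, s)
         + (\<Sum>i<n. \<Sum>j\<in>{i..<n}. C $$ (i, j) * P i j $$ (r, s))
         + (\<Sum>i<n. c $ i * Q i $$ (r, s))))}"
    by blast
  moreover have "0\<^sub>m n n \<in> sym_mats n"
    by (auto simp: sym_mats_def)
  ultimately show ?thesis
    unfolding spectrahedron_def using Psym Qsym by blast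
qed

lemma S_set_eq_switch_image: "S_set n = switch n (vec n (\<lambda>_. 1)) ` S_set n"
proof -
  have "switch n (vec n (\<lambda>_. 1)) p = p" if "p \<in> sym_vec_space n" for p
    using that by (cases p) (auto simp: switch_def signed_mat_def sym_vec_space_def sym_mats_def
        intro!: eq_matI eq_vecI)
  then have "switch n (vec n (\<lambda>_. 1)) p = p" if "p \<in> S_set n" for p
    using that by (auto simp: S_set_def)
  then show ?thesis
    by (metis (no_types, lifting) image_cong image_ident)
qed

section \<open>The diagonal matrices act by switching\<close>

definition sign_diag :: "nat \<Rightarrow> real vec \<Rightarrow> real mat" where
  "sign_diag n x =
     Diag (map (\<lambda>(i, j). x $ i * x $ j) (upper_pairs n) @ map (\<lambda>i. x $ i) [0..<n])"

lemma sign_group_eq: "sign_group n = sign_diag n ` sign_vecs n"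
  by (auto simp: sign_group_def sign_diag_def sign_vecs_def)

lemma sign_diag_carrier: "sign_diag n x \<in> carrier_mat (n * (n + 1) div 2) (n * (n + 1) div 2)"
  by (simp add: sign_diag_def Diag_def length_upper_pairs)

lemma Diag_mult_vec:
  assumes "length xs = length ys"
  shows "Diag xs *\<^sub>v vec_of_list ys = vec_of_list (map2 (*) xs ys)"
proof (rule eq_vecI)
  fix k
  assume "k < dim_vec (vec_of_list (map2 (*) xs ys))"
  then have k: "k < length xs" "k < length ys"
    using assms by simp_all
  then have "(Diag xs *\<^sub>v vec_of_list ys) $ k = xs ! k * ys ! k"
    using assms by (simp add: Diag_def scalar_prod_def vec_of_list_index mult_if_zero)
  then show "(Diag xs *\<^sub>v vec_of_list ys) $ k = vec_of_list (map2 (*) xs ys) $ k"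
    using k by (simp add: vec_of_list_index)
qed (use assms in \<open>simp add: Diag_def\<close>)

text \<open>
  The action is only described by coordinates and diagonal entries, and these determine a pair
  uniquely, so it suffices that switching has the right ones.
\<close>
lemma act_sign_diag:
  assumes x: "x \<in> sign_vecs n" and p: "p \<in> sym_vec_space n"
  shows "act n (sign_diag n x) p = switch n x p"
proof -
  obtain C c where pC: "p = (C, c)"
    by (cases p)
  have "map2 (*) (map (\<lambda>(i, j). x $ i * x $ j) (upper_pairs n)) (map (\<lambda>ij. C $$ ij) (upper_pairs n))
      = map (\<lambda>ij. signed_mat n x C $$ ij) (upper_pairs n)"
    by (auto simp: zip_map_map zip_same_conv_map set_upper_pairs signed_mat_def)
  moreover have "map2 (*) (map (\<lambda>i. x $ i) [0..<n]) (map (\<lambda>i. c $ i) [0..<n])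
      = map (\<lambda>i. vec n (\<lambda>i. x $ i * c $ i) $ i) [0..<n]"
    by (auto simp: zip_map_map zip_same_conv_map)
  ultimately have "coord_vec n (switch n x p) = sign_diag n x *\<^sub>v coord_vec n p"
    by (simp add: coord_vec_def sign_diag_def Diag_mult_vec switch_def pC del: map_map)
  moreover have "fst (switch n x p) $$ (i, i) = fst p $$ (i, i)" if "i < n" for i
    using that sign_vecs_square[OF x] by (simp add: switch_def signed_mat_def)
  ultimately show ?thesis
    unfolding act_def using act_ex1[OF p sign_diag_carrier] switch_in_space[OF p]
    by (intro the1_equality) auto
qed

lemma act_image_S_set:
  assumes "x \<in> sign_vecs n"
  shows "act n (sign_diag n x) ` S_set n = switch n x ` S_set n"
  using act_sign_diag[OF assms] by (intro image_cong) (auto simp: S_set_def)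

lemma invertible_linear_act:
  assumes x: "x \<in> sign_vecs n"
  shows "invertible_linear n (act n (sign_diag n x))"
proof -
  have act: "act n (sign_diag n x) (C, c) = switch n x (C, c)" if "(C, c) \<in> sym_vec_space n" for C c
    using act_sign_diag[OF x that] .
  have "bij_betw (switch n x) (sym_vec_space n) (sym_vec_space n)"
    using switch_switch[OF x] switch_in_space
    by (intro bij_betw_byWitness[where f' = "switch n x"]) auto
  then have bij: "bij_betw (act n (sign_diag n x)) (sym_vec_space n) (sym_vec_space n)"
    using act_sign_diag[OF x] by (simp cong: bij_betw_cong)
  have add: "(C + D, c + d) \<in> sym_vec_space n"
    if "(C, c) \<in> sym_vec_space n" "(D, d) \<in> sym_vec_space n" for C D c d
    using that by (auto simp: sym_vec_space_def sym_mats_def transpose_add)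
  have smult: "(t \<cdot>\<^sub>m C, t \<cdot>\<^sub>v c) \<in> sym_vec_space n"
    if "(C, c) \<in> sym_vec_space n" for t C c
    using that sym_mats_entry[of C n]
    by (auto simp: sym_vec_space_def sym_mats_def intro!: eq_matI)
  have sadd: "switch n x (C + D, c + d) =
      (fst (switch n x (C, c)) + fst (switch n x (D, d)), snd (switch n x (C, c)) + snd (switch n x (D, d)))"
    if "(C, c) \<in> sym_vec_space n" "(D, d) \<in> sym_vec_space n" for C D c d
    using that by (auto simp: switch_def signed_mat_def sym_vec_space_def sym_mats_def algebra_simps
        intro!: eq_matI eq_vecI)
  have ssmult: "switch n x (t \<cdot>\<^sub>m C, t \<cdot>\<^sub>v c) =
      (t \<cdot>\<^sub>m fst (switch n x (C, c)), t \<cdot>\<^sub>v snd (switch n x (C, c)))"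
    if "(C, c) \<in> sym_vec_space n" for t C c
    using that by (auto simp: switch_def signed_mat_def sym_vec_space_def sym_mats_def algebra_simps
        intro!: eq_matI eq_vecI)
  show ?thesis
    unfolding invertible_linear_def
    using bij add smult sadd ssmult by (simp add: act)
qed

section \<open>The sign group\<close>

lemma Diag_mult:
  assumes "length xs = length ys"
  shows "Diag xs * Diag ys = Diag (map2 (*) xs ys)"
proof (rule eq_matI)
  fix i j
  assume "i < dim_row (Diag (map2 (*) xs ys))" "j < dim_col (Diag (map2 (*) xs ys))"
  then have ij: "i < length ys" "j < length ys"
    using assms by (simp_all add: Diag_def)
  then have "(Diag xs * Diag ys) $$ (i, j) = (if i = j then xs ! i * ys ! i else 0)"
    using assms by (simp add: Diag_def scalar_prod_def mult_if_zero)
  then show "(Diag xs * Diag ys) $$ (i, j) = Diag (map2 (*) xs ys) $$ (i, j)"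
    using ij assms by (simp add: Diag_def)
qed (use assms in \<open>simp_all add: Diag_def\<close>)

lemma sign_diag_mult:
  "sign_diag n x * sign_diag n y = sign_diag n (vec n (\<lambda>i. x $ i * y $ i))"
proof -
  let ?xy = "vec n (\<lambda>i. x $ i * y $ i)"
  have "map2 (*) (map (\<lambda>(i, j). x $ i * x $ j) (upper_pairs n)) (map (\<lambda>(i, j). y $ i * y $ j) (upper_pairs n))
      = map (\<lambda>(i, j). ?xy $ i * ?xy $ j) (upper_pairs n)"
    by (auto simp: zip_map_map zip_same_conv_map set_upper_pairs)
  moreover have "map2 (*) (map (\<lambda>i. x $ i) [0..<n]) (map (\<lambda>i. y $ i) [0..<n])
      = map (\<lambda>i. ?xy $ i) [0..<n]"
    by (auto simp: zip_map_map zip_same_conv_map)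
  ultimately show ?thesis
    by (simp add: sign_diag_def Diag_mult del: map_map)
qed

lemma sign_diag_one: "sign_diag n (vec n (\<lambda>_. 1)) = 1\<^sub>m (n * (n + 1) div 2)"
proof -
  have "map (\<lambda>(i, j). vec n (\<lambda>_. 1) $ i * vec n (\<lambda>_. 1) $ j) (upper_pairs n)
      = replicate (length (upper_pairs n)) (1::real)"
    by (intro replicate_eqI) (auto simp: set_upper_pairs)
  moreover have "map (\<lambda>i. vec n (\<lambda>_. 1) $ i) [0..<n] = replicate n (1::real)"
    by (intro replicate_eqI) auto
  ultimately show ?thesis
    unfolding sign_diag_def
    by (auto simp: Diag_def length_upper_pairs simp flip: replicate_add intro!: eq_matI)
qed

text \<open>
  The last \<open>n\<close> diagonal entries are the components of \<open>x\<close> themselves.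
\<close>
lemma inj_on_sign_diag: "inj_on (sign_diag n) (sign_vecs n)"
proof (rule inj_onI)
  fix x y
  assume x: "x \<in> sign_vecs n" and y: "y \<in> sign_vecs n" and eq: "sign_diag n x = sign_diag n y"
  have entry: "sign_diag n z $$ (length (upper_pairs n) + i, length (upper_pairs n) + i) = z $ i"
    if "i < n" for z i
    using that by (simp add: sign_diag_def Diag_def nth_append)
  have "x $ i = y $ i" if "i < n" for i
    using entry[OF that] eq by metis
  then show "x = y"
    using x y by (intro eq_vecI) (auto simp: sign_vecs_def)
qed

lemma sign_diag_in_GL:
  assumes x: "x \<in> sign_vecs n"
  shows "sign_diag n x \<in> carrier (GL (n * (n + 1) div 2))"
proof -
  have "vec n (\<lambda>i. x $ i * x $ i) = vec n (\<lambda>_. 1)"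
    using sign_vecs_square[OF x] by (intro eq_vecI) auto
  then have "sign_diag n x * sign_diag n x = 1\<^sub>m (n * (n + 1) div 2)"
    by (simp add: sign_diag_mult sign_diag_one)
  then show ?thesis
    using sign_diag_carrier[of n x]
    by (auto simp: GL_def units_of_carrier Units_def ring_mat_simps)
qed

lemma group_GL: "group (GL N)"
  unfolding GL_def using ring_mat[where 'a = real, of N "()"]
  by (simp add: monoid.units_group ring.is_monoid)

text \<open>
  The exponent of the sign at position \<open>i\<close> is \<open>f (i + 1)\<close>: vectors are indexed from 0, the factors
  of the product group from 1.
\<close>
definition signs :: "nat \<Rightarrow> (nat \<Rightarrow> int) \<Rightarrow> real vec" where
  "signs n f = vec n (\<lambda>i. if f (Suc i) = 0 then 1 else -1)"

abbreviation Z2_power :: "nat \<Rightarrow> (nat \<Rightarrow> int) monoid" where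
  "Z2_power n \<equiv> product_group {1..n} (\<lambda>_. integer_mod_group 2)"

lemma bij_betw_signs: "bij_betw (signs n) (carrier (Z2_power n)) (sign_vecs n)"
proof (rule bij_betw_byWitness[where f' = "\<lambda>x. \<lambda>i\<in>{1..n}. if x $ (i - 1) = 1 then 0 else 1"])
  show "\<forall>f \<in> carrier (Z2_power n). (\<lambda>i\<in>{1..n}. if signs n f $ (i - 1) = 1 then 0 else 1) = f"
  proof
    fix f
    assume "f \<in> carrier (Z2_power n)"
    then have f: "f \<in> (\<Pi>\<^sub>E i\<in>{1..n}. {0..<2})"
      by (simp add: carrier_integer_mod_group)
    show "(\<lambda>i\<in>{1..n}. if signs n f $ (i - 1) = 1 then 0 else 1) = f"
    proof
      fix i
      show "(\<lambda>i\<in>{1..n}. if signs n f $ (i - 1) = 1 then 0 else 1) i = f i"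
      proof (cases "i \<in> {1..n}")
        case True
        then have "f i \<in> {0..<2}"
          using f by (meson PiE_mem)
        then have "f i = 0 \<or> f i = 1"
          by auto
        then show ?thesis
          using True by (auto simp: signs_def)
      next
        case False
        then show ?thesis
          by (simp only: restrict_apply if_False PiE_arb[OF f False])
      qed
    qed
  qed
  show "\<forall>x \<in> sign_vecs n. signs n (\<lambda>i\<in>{1..n}. if x $ (i - 1) = 1 then 0 else 1) = x"
  proof
    fix x
    assume "x \<in> sign_vecs n"
    then have "x \<in> carrier_vec n" "\<And>i. i < n \<Longrightarrow> x $ i = -1 \<or> x $ i = 1"
      by (auto simp: sign_vecs_def)
    then show "signs n (\<lambda>i\<in>{1..n}. if x $ (i - 1) = 1 then 0 else 1) = x"
      unfolding signs_def by (intro eq_vecI) fastforce+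
  qed
  show "signs n ` carrier (Z2_power n) \<subseteq> sign_vecs n"
    by (simp add: image_subset_iff signs_def sign_vecs_def)
  show "(\<lambda>x. \<lambda>i\<in>{1..n}. if x $ (i - 1) = 1 then 0 else 1) ` sign_vecs n \<subseteq> carrier (Z2_power n)"
    by (simp add: image_subset_iff restrict_PiE_iff carrier_integer_mod_group)
qed

lemma card_sign_vecs: "card (sign_vecs n) = 2 ^ n"
proof -
  have "card (sign_vecs n) = card (carrier (Z2_power n))"
    using bij_betw_same_card[OF bij_betw_signs] by simp
  then show ?thesis
    by (simp add: card_PiE carrier_integer_mod_group)
qed

lemma sign_diag_signs_mult:
  assumes f: "f \<in> carrier (Z2_power n)" and g: "g \<in> carrier (Z2_power n)"
  shows "sign_diag n (signs n (f \<otimes>\<^bsub>Z2_power n\<^esub> g)) = sign_diag n (signs n f) * sign_diag n (signs n g)"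
proof -
  have bit: "h (Suc i) = 0 \<or> h (Suc i) = 1" if "h \<in> carrier (Z2_power n)" "i < n" for h i
  proof -
    have "h (Suc i) \<in> {0..<2}"
      using that by (auto simp: carrier_integer_mod_group PiE_iff)
    then show ?thesis
      by auto
  qed
  have "signs n (f \<otimes>\<^bsub>Z2_power n\<^esub> g) = vec n (\<lambda>i. signs n f $ i * signs n g $ i)"
  proof (rule eq_vecI)
    fix i
    assume "i < dim_vec (vec n (\<lambda>i. signs n f $ i * signs n g $ i))"
    then have "i < n"
      by simp
    then show "signs n (f \<otimes>\<^bsub>Z2_power n\<^esub> g) $ i = vec n (\<lambda>i. signs n f $ i * signs n g $ i) $ i"
      using bit[OF f \<open>i < n\<close>] bit[OF g \<open>i < n\<close>] by (auto simp: signs_def)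
  qed (simp add: signs_def)
  then show ?thesis
    by (simp add: sign_diag_mult)
qed

text \<open>
  The subgroup and the isomorphism come from one map: an injective homomorphism is an isomorphism
  onto its image, and the image of this one is the sign group.
\<close>
lemma sign_group_structure:
  "subgroup (sign_group n) (GL (n * (n + 1) div 2))"
  "(GL (n * (n + 1) div 2))\<lparr>carrier := sign_group n\<rparr> \<cong> Z2_power n"
proof -
  let ?GL = "GL (n * (n + 1) div 2)"
  let ?\<phi> = "sign_diag n \<circ> signs n"
  have Z: "group (Z2_power n)"
    by simp
  have bij: "bij_betw ?\<phi> (carrier (Z2_power n)) (sign_group n)"
    unfolding sign_group_eq
    using bij_betw_signs inj_on_sign_diag by (metis bij_betw_trans inj_on_imp_bij_betw)
  have mem: "?\<phi> f \<in> carrier ?GL" if "f \<in> carrier (Z2_power n)" for f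
    using sign_diag_in_GL bij_betw_apply[OF bij_betw_signs that] by simp
  have mult: "?\<phi> (f \<otimes>\<^bsub>Z2_power n\<^esub> g) = ?\<phi> f \<otimes>\<^bsub>?GL\<^esub> ?\<phi> g"
    if "f \<in> carrier (Z2_power n)" "g \<in> carrier (Z2_power n)" for f g
    using sign_diag_signs_mult[OF that] by (simp add: GL_def units_of_mult ring_mat_simps)
  have "?\<phi> \<in> hom (Z2_power n) ?GL"
    unfolding hom_def using mem mult by blast
  then interpret group_hom "Z2_power n" ?GL ?\<phi>
    using Z group_GL by (simp add: group_hom_def group_hom_axioms_def)
  show "subgroup (sign_group n) ?GL"
    using img_is_subgroup bij by (simp add: bij_betw_def)
  have "?\<phi> \<in> iso (Z2_power n) (?GL\<lparr>carrier := sign_group n\<rparr>)"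
    unfolding iso_def hom_def using bij mult by (auto dest: bij_betw_apply)
  then show "?GL\<lparr>carrier := sign_group n\<rparr> \<cong> Z2_power n"
    using group.iso_sym[OF Z] by (auto simp: is_iso_def)
qed

theorem theorem4p1:
  fixes n :: nat
  assumes "n \<ge> 1"
  shows "sdp_exact_region n (binary_polys n) = (\<Union>g \<in> sign_group n. act n g ` S_set n)
    \<and> card ((\<lambda>g. act n g ` S_set n) ` sign_group n) = 2 ^ n
    \<and> spectrahedron n (S_set n)
    \<and> (\<forall>g \<in> sign_group n.
          invertible_linear n (act n g) \<and> spectrahedron n (act n g ` S_set n))
    \<and> subgroup (sign_group n) (GL (n * (n + 1) div 2))
    \<and> (GL (n * (n + 1) div 2))\<lparr>carrier := sign_group n\<rparr>
        \<cong> product_group {1..n} (\<lambda>_. integer_mod_group 2)"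
proof -
  have region: "sdp_exact_region n (binary_polys n) = (\<Union>g \<in> sign_group n. act n g ` S_set n)"
    by (simp add: sdp_exact_region_switch sign_group_eq act_image_S_set)
  have "inj_on (\<lambda>g. act n g ` S_set n) (sign_group n)"
    unfolding sign_group_eq
    using switch_image_eq_imp_eq by (force simp: inj_on_def act_image_S_set)
  then have pieces: "card ((\<lambda>g. act n g ` S_set n) ` sign_group n) = 2 ^ n"
    by (simp add: card_image sign_group_eq inj_on_sign_diag card_sign_vecs)
  have "vec n (\<lambda>_. 1) \<in> sign_vecs n"
    by (simp add: sign_vecs_def)
  then have S: "spectrahedron n (S_set n)"
    using spectrahedron_switch S_set_eq_switch_image by metis
  have "\<forall>g \<in> sign_group n. invertible_linear n (act n g) \<and> spectrahedron n (act n g ` S_set n)"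
    by (auto simp: sign_group_eq act_image_S_set invertible_linear_act spectrahedron_switch)
  with region pieces S sign_group_structure[of n] show ?thesis
    by blast
qed

end
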